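(* Assume that there exists an $(m,\varepsilon)$-almost net $P\subseteq [0,1]^d$ in base $q$. Then the following holds. If $\varepsilon\geq 1/(2\sqrt{d})$, then $m= \Omega\bigl(\frac{\log d}{q^2\varepsilon^2\log(1/\varepsilon)}\bigr)$. If $1/(2\sqrt{d})\geq \varepsilon\geq e^{-d/8}$, then $m= \Omega(q^{-2k-2}\varepsilon^{-2})$, where $k=\frac{2\log(1/\varepsilon)}{\log d-\log\log(1/\varepsilon)}$. In particular, if $\varepsilon=\omega(d^{-t})$ for some constant $t$, then $m= \Omega_{q,t}(1/\varepsilon^2)$. If $\varepsilon=o(e^{-cd})$ for some constant $c$ with $0<c<\min(1/8,1/q^2)$, then $m=\Omega\bigl(q^{-2}e^{c'd}\bigr)$, where $c'=2c(1-2\log q/\log(1/c))$.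
   Context: A subinterval of $[0,1]$ is basic (in base $q$) if it is of the form $[a/q^k,(a+1)/q^k)$ for nonnegative integers $a,k$; a basic box is a product of $d$ basic intervals. A set $P\subset[0,1]^d$ is an $(m,\varepsilon)$-almost net in base $q$ if $|P|=q^n m$ for some natural number $n$ and $(1-\varepsilon)m\leq |\beta\cap P|\leq (1+\varepsilon)m$ for every basic box $\beta$ of volume $q^{-n}$.
   Formalization: The claims fail for small n (n=0, P={0}, m=1) and for ε near 1, so |P|=q^n m is required with n≥2 in claim 1 and n≥2⌈k⌉ in claims 2–4 (k taken at ε=e^{-cd} in claim 4); claim 1 has ε≤ε₀<1 with constant depending on ε₀; claim 3 has ε<1. *)

theory Defs
  imports "HOL-Analysis.Analysis" "HOL-Library.Landau_Symbols"
begin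

text \<open>
  The dimension \<open>d\<close> is a quantity in the asymptotic estimates, so points of the unit cube
  are extensional functions on \<open>{..<d}\<close> rather than vectors over a finite index type.
\<close>

definition unit_cube :: "nat \<Rightarrow> (nat \<Rightarrow> real) set" where
  "unit_cube d = (\<Pi>\<^sub>E i\<in>{..<d}. {0..1})"

definition basic_interval :: "nat \<Rightarrow> real set \<Rightarrow> bool" where
  "basic_interval q I \<longleftrightarrow>
     I \<subseteq> {0..1} \<and> (\<exists>a k::nat. I = {real a / real q ^ k ..< (real a + 1) / real q ^ k})"

definition basic_box :: "nat \<Rightarrow> nat \<Rightarrow> (nat \<Rightarrow> real) set \<Rightarrow> bool" where
  "basic_box d q B \<longleftrightarrow> (\<exists>I. (\<forall>i<d. basic_interval q (I i)) \<and> B = (\<Pi>\<^sub>E i\<in>{..<d}. I i))"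

definition box_volume :: "nat \<Rightarrow> (nat \<Rightarrow> real) set \<Rightarrow> real" where
  "box_volume d B = measure (\<Pi>\<^sub>M i\<in>{..<d}. lborel) B"

text \<open>
  The exponent \<open>n\<close> is a parameter here; an \<open>(m, \<epsilon>)\<close>-almost net is a set \<open>P\<close> for which
  \<open>almost_net d q n m \<epsilon> P\<close> holds for some \<open>n\<close>. The lower bounds need \<open>n\<close> not to be too small:
  for \<open>n = 0\<close> the set consisting of the origin alone satisfies the definition with \<open>m = 1\<close>
  for every \<open>\<epsilon> \<ge> 0\<close>.
\<close>

definition almost_net ::
    "nat \<Rightarrow> nat \<Rightarrow> nat \<Rightarrow> real \<Rightarrow> real \<Rightarrow> (nat \<Rightarrow> real) set \<Rightarrow> bool" where
  "almost_net d q n m \<epsilon> P \<longleftrightarrow>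
     finite P \<and> P \<subseteq> unit_cube d \<and> real (card P) = real q ^ n * m \<and>
     (\<forall>B. basic_box d q B \<and> box_volume d B = 1 / real q ^ n \<longrightarrow>
        (1 - \<epsilon>) * m \<le> real (card (B \<inter> P)) \<and> real (card (B \<inter> P)) \<le> (1 + \<epsilon>) * m)"

definition net_exponent :: "nat \<Rightarrow> real \<Rightarrow> real" where
  "net_exponent d \<epsilon> = 2 * ln (1 / \<epsilon>) / (ln (real d) - ln (ln (1 / \<epsilon>)))"

end

theory Submission
  imports Defs "HOL-Library.Multiset" "HOL-Real_Asymp.Real_Asymp"
begin

text \<open>
  Fix \<open>k\<close> with \<open>2 k \<le> n\<close> and keep the points \<open>x\<close> of \<open>P\<close> with \<open>x\<^sub>0 < q ^ (2 k - n)\<close>; there are about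
  \<open>m q ^ (2 k)\<close> of them. Let \<open>f\<close> be \<open>1\<close>, \<open>- 1\<close>, \<open>0\<close> according to whether the first \<open>q\<close>-ary digit is
  \<open>0\<close>, \<open>1\<close> or larger. The products of \<open>f (x\<^sub>i)\<close> over \<open>k\<close>-sets of coordinates involve only \<open>2 k\<close>
  digits in pairs, so the net property makes them nearly orthogonal on the slice, with equal norms
  up to a factor \<open>1 \<plusminus> \<epsilon>\<close>. Comparing the trace of their Gram matrix, or of its entrywise \<open>p\<close>-th power
  (Alon's argument), with its Frobenius norm bounds the number of points of the slice from below.
  One takes \<open>k = 1\<close> and \<open>p\<close> about \<open>log d / (2 log (1 / \<epsilon>))\<close> for large \<open>\<epsilon>\<close>, and \<open>p = 1\<close>,
  \<open>k = \<lceil>net_exponent d \<epsilon>\<rceil>\<close> for small \<open>\<epsilon>\<close>. When \<open>\<epsilon>\<close> is bounded below it suffices that the sets of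
  points whose \<open>i\<close>-th digit is \<open>0\<close> are distinct for distinct \<open>i\<close>.
\<close>

section \<open>Gram matrices\<close>

text \<open>Both the Gram matrix and the matrix \<open>H\<close> on \<open>X\<close>, formed from
  the same vectors, have the same trace and the same Frobenius norm. Cauchy-Schwarz on the
  \<open>card X\<close> diagonal entries of \<open>H\<close> does the rest, so \<open>card X\<close>
  stands where the rank would.\<close>

lemma gram_trace_bound:
  fixes v :: "'i \<Rightarrow> 'x \<Rightarrow> real"
  assumes "finite X"
  shows "(\<Sum>i\<in>I. \<Sum>x\<in>X. (v i x)\<^sup>2)\<^sup>2 \<le> real (card X) * (\<Sum>i\<in>I. \<Sum>j\<in>I. (\<Sum>x\<in>X. v i x * v j x)\<^sup>2)"
proof -
  define H where "H x y = (\<Sum>i\<in>I. v i x * v i y)" for x y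
  have "(\<Sum>i\<in>I. \<Sum>x\<in>X. (v i x)\<^sup>2) = (\<Sum>x\<in>X. H x x)"
    unfolding H_def by (subst sum.swap) (simp add: power2_eq_square)
  hence "(\<Sum>i\<in>I. \<Sum>x\<in>X. (v i x)\<^sup>2)\<^sup>2 \<le> real (card X) * (\<Sum>x\<in>X. (H x x)\<^sup>2)"
    using sum_squared_le_sum_of_squares[of "\<lambda>x. H x x" X] by (simp add: mult.commute)
  also have "\<dots> \<le> real (card X) * (\<Sum>x\<in>X. \<Sum>y\<in>X. (H x y)\<^sup>2)"
    by (intro mult_left_mono sum_mono member_le_sum assms) auto
  also have "(\<Sum>x\<in>X. \<Sum>y\<in>X. (H x y)\<^sup>2) =
      (\<Sum>x\<in>X. \<Sum>y\<in>X. \<Sum>i\<in>I. \<Sum>j\<in>I. (v i x * v i y) * (v j x * v j y))"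
    by (simp add: H_def power2_eq_square sum_product)
  also have "\<dots> = (\<Sum>x\<in>X. \<Sum>i\<in>I. \<Sum>y\<in>X. \<Sum>j\<in>I. (v i x * v i y) * (v j x * v j y))"
    by (intro sum.cong sum.swap refl)
  also have "\<dots> = (\<Sum>i\<in>I. \<Sum>x\<in>X. \<Sum>y\<in>X. \<Sum>j\<in>I. (v i x * v i y) * (v j x * v j y))"
    by (rule sum.swap)
  also have "\<dots> = (\<Sum>i\<in>I. \<Sum>x\<in>X. \<Sum>j\<in>I. \<Sum>y\<in>X. (v i x * v i y) * (v j x * v j y))"
    by (intro sum.cong sum.swap refl)
  also have "\<dots> = (\<Sum>i\<in>I. \<Sum>j\<in>I. \<Sum>x\<in>X. \<Sum>y\<in>X. (v i x * v i y) * (v j x * v j y))"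
    by (intro sum.cong sum.swap refl)
  also have "\<dots> = (\<Sum>i\<in>I. \<Sum>j\<in>I. (\<Sum>x\<in>X. v i x * v j x)\<^sup>2)"
    by (simp add: power2_eq_square sum_product mult_ac)
  finally show ?thesis .
qed

text \<open>The power of the sum is expanded over words rather than multinomially, so that the words
  can later be grouped by their multiset.\<close>

lemma sum_prod_list_lists_length:
  fixes h :: "'x \<Rightarrow> 'r::comm_semiring_1"
  assumes "finite X"
  shows "(\<Sum>xs | set xs \<subseteq> X \<and> length xs = p. prod_list (map h xs)) = (\<Sum>x\<in>X. h x) ^ p"
proof (induction p)
  case 0
  have "{xs. set xs \<subseteq> X \<and> length xs = 0} = {[]}" by auto
  thus ?case by simp
next
  case (Suc p)
  have "inj_on (\<lambda>z. snd z # fst z) ({xs. set xs \<subseteq> X \<and> length xs = p} \<times> X)"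
    by (auto simp: inj_on_def prod_eq_iff)
  hence "(\<Sum>xs | set xs \<subseteq> X \<and> length xs = Suc p. prod_list (map h xs)) =
      (\<Sum>(xs, x)\<in>{xs. set xs \<subseteq> X \<and> length xs = p} \<times> X. h x * prod_list (map h xs))"
    by (simp add: lists_length_Suc_eq sum.reindex case_prod_beta)
  also have "\<dots> = (\<Sum>x\<in>X. h x) * (\<Sum>xs | set xs \<subseteq> X \<and> length xs = p. prod_list (map h xs))"
    by (simp add: sum_product sum.cartesian_product[symmetric] sum.swap[of _ _ X])
  finally show ?case by (simp add: Suc)
qed

text \<open>
  The \<open>p\<close>-th symmetric tensor power turns the Gram matrix into its \<open>p\<close>-th entrywise power;
  the coordinates of the tensors are indexed by multisets.
\<close>
lemma gram_power_trace_bound: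
  fixes v :: "'i \<Rightarrow> 'x \<Rightarrow> real"
  assumes X: "finite X"
  shows "(\<Sum>i\<in>I. (\<Sum>x\<in>X. (v i x)\<^sup>2) ^ p)\<^sup>2 \<le>
    real ((card X + p - 1) choose p) * (\<Sum>i\<in>I. \<Sum>j\<in>I. (\<Sum>x\<in>X. v i x * v j x) ^ (2 * p))"
proof -
  define L where "L = {xs. set xs \<subseteq> X \<and> length xs = p}"
  define MS where "MS = multisets_of_size X p"
  define c where "c \<mu> = real (card {xs \<in> L. mset xs = \<mu>})" for \<mu>
  \<comment> \<open>\<open>c \<mu>\<close> is a multinomial coefficient. Its square root enters both
    tensors of an inner product, so each word with multiset \<mu> is counted exactly once.\<close>
  define u where "u i \<mu> = sqrt (c \<mu>) * prod_mset (image_mset (v i) \<mu>)" for i \<mu>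
  have L: "finite L" unfolding L_def by (rule finite_lists_length_eq[OF X])
  have MS: "finite MS" unfolding MS_def by (rule finite_multisets_of_size[OF X])
  have uu: "(\<Sum>\<mu>\<in>MS. u i \<mu> * u j \<mu>) = (\<Sum>x\<in>X. v i x * v j x) ^ p" for i j
  proof -
    have "u i \<mu> * u j \<mu> =
        (\<Sum>xs | xs \<in> L \<and> mset xs = \<mu>. prod_list (map (\<lambda>x. v i x * v j x) xs))" for \<mu>
    proof -
      have "prod_list (map (\<lambda>x. v i x * v j x) xs) =
          prod_mset (image_mset (v i) (mset xs)) * prod_mset (image_mset (v j) (mset xs))" for xs
        by (induction xs) (auto simp: mult_ac)
      hence "(\<Sum>xs | xs \<in> L \<and> mset xs = \<mu>. prod_list (map (\<lambda>x. v i x * v j x) xs)) =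
          (\<Sum>xs | xs \<in> L \<and> mset xs = \<mu>.
             prod_mset (image_mset (v i) \<mu>) * prod_mset (image_mset (v j) \<mu>))"
        by (intro sum.cong) auto
      also have "\<dots> = c \<mu> * (prod_mset (image_mset (v i) \<mu>) * prod_mset (image_mset (v j) \<mu>))"
        by (simp add: c_def)
      also have "\<dots> = (sqrt (c \<mu>) * sqrt (c \<mu>)) *
          (prod_mset (image_mset (v i) \<mu>) * prod_mset (image_mset (v j) \<mu>))"
        by (simp add: c_def)
      finally show ?thesis by (simp add: u_def mult_ac)
    qed
    hence "(\<Sum>\<mu>\<in>MS. u i \<mu> * u j \<mu>) =
        (\<Sum>\<mu>\<in>MS. \<Sum>xs | xs \<in> L \<and> mset xs = \<mu>. prod_list (map (\<lambda>x. v i x * v j x) xs))"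
      by simp
    also have "\<dots> = (\<Sum>xs\<in>L. prod_list (map (\<lambda>x. v i x * v j x) xs))"
      by (intro sum.group L MS) (auto simp: L_def MS_def multisets_of_size_def)
    finally show ?thesis by (simp add: L_def sum_prod_list_lists_length[OF X])
  qed
  have "(\<Sum>\<mu>\<in>MS. (u i \<mu>)\<^sup>2) = (\<Sum>x\<in>X. (v i x)\<^sup>2) ^ p" for i
    using uu[of i i] by (simp add: power2_eq_square)
  moreover have "(\<Sum>\<mu>\<in>MS. u i \<mu> * u j \<mu>)\<^sup>2 = (\<Sum>x\<in>X. v i x * v j x) ^ (2 * p)" for i j
    by (simp add: uu power_mult mult.commute[of 2])
  moreover have "card MS = (card X + p - 1) choose p"
    unfolding MS_def by (rule card_multisets_of_size[OF X])
  ultimately show ?thesis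
    using gram_trace_bound[OF MS, where I = I and v = u] by simp
qed

text \<open>In the power bound, each diagonal entry contributes at least
  \<open>((1 - \<epsilon>) * A) ^ p\<close> on the left. On the right the even exponent removes
  signs, and a factor \<open>card I * A ^ (2 * p)\<close> cancels. A larger \<open>p\<close>
  suppresses the off-diagonal terms at the price of a larger binomial coefficient.\<close>

lemma near_orthogonal_card_bound:
  fixes v :: "'i \<Rightarrow> 'x \<Rightarrow> real"
  assumes X: "finite X" and I: "finite I"
    and A: "0 < A" and e: "0 \<le> \<epsilon>" "\<epsilon> \<le> 1"
    and diag: "\<And>i. i \<in> I \<Longrightarrow> \<bar>(\<Sum>x\<in>X. (v i x)\<^sup>2) - A\<bar> \<le> \<epsilon> * A"
    and off: "\<And>i j. i \<in> I \<Longrightarrow> j \<in> I \<Longrightarrow> i \<noteq> j \<Longrightarrow> \<bar>\<Sum>x\<in>X. v i x * v j x\<bar> \<le> \<epsilon> * A"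
  shows "real (card I) * (1 - \<epsilon>) ^ (2 * p) \<le>
    real ((card X + p - 1) choose p) * ((1 + \<epsilon>) ^ (2 * p) + real (card I) * \<epsilon> ^ (2 * p))"
proof (cases "I = {}")
  case False
  define N R where "N = real (card I)" and "R = real ((card X + p - 1) choose p)"
  have N: "N > 0" using False I by (simp add: N_def card_gt_0_iff)
  have "N * ((1 - \<epsilon>) * A) ^ p = (\<Sum>i\<in>I. ((1 - \<epsilon>) * A) ^ p)" by (simp add: N_def)
  also have "\<dots> \<le> (\<Sum>i\<in>I. (\<Sum>x\<in>X. (v i x)\<^sup>2) ^ p)"
    using diag e A by (intro sum_mono power_mono) (auto simp: abs_le_iff algebra_simps)
  finally have "(N * ((1 - \<epsilon>) * A) ^ p)\<^sup>2 \<le> (\<Sum>i\<in>I. (\<Sum>x\<in>X. (v i x)\<^sup>2) ^ p)\<^sup>2"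
    using N e A by (intro power_mono) auto
  also have "\<dots> \<le> R * (\<Sum>i\<in>I. \<Sum>j\<in>I. (\<Sum>x\<in>X. v i x * v j x) ^ (2 * p))"
    unfolding R_def by (rule gram_power_trace_bound[OF X])
  also have "\<dots> \<le> R * (\<Sum>i\<in>I. \<Sum>j\<in>I. (if i = j then ((1 + \<epsilon>) * A) ^ (2 * p) else 0) + (\<epsilon> * A) ^ (2 * p))"
  proof (intro mult_left_mono sum_mono)
    fix i j assume ij: "i \<in> I" "j \<in> I"
    have "(\<Sum>x\<in>X. v i x * v j x) ^ (2 * p) = \<bar>\<Sum>x\<in>X. v i x * v j x\<bar> ^ (2 * p)"
      by (simp add: power_even_abs)
    also have "\<dots> \<le> (if i = j then ((1 + \<epsilon>) * A) ^ (2 * p) else (\<epsilon> * A) ^ (2 * p))"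
    proof (cases "i = j")
      case True
      have "\<bar>\<Sum>x\<in>X. v i x * v i x\<bar> \<le> (1 + \<epsilon>) * A"
        using diag[OF ij(1)] sum_nonneg[of X "\<lambda>x. v i x * v i x"]
        by (simp add: power2_eq_square algebra_simps abs_le_iff)
      thus ?thesis using True by (auto intro: power_mono)
    next
      case False
      thus ?thesis using off[OF ij] by (auto intro: power_mono)
    qed
    also have "\<dots> \<le> (if i = j then ((1 + \<epsilon>) * A) ^ (2 * p) else 0) + (\<epsilon> * A) ^ (2 * p)"
      using e A by auto
    finally show "(\<Sum>x\<in>X. v i x * v j x) ^ (2 * p) \<le>
        (if i = j then ((1 + \<epsilon>) * A) ^ (2 * p) else 0) + (\<epsilon> * A) ^ (2 * p)" .
  qed (auto simp: R_def)
  also have "\<dots> = (N * A ^ (2 * p)) * (R * ((1 + \<epsilon>) ^ (2 * p) + N * \<epsilon> ^ (2 * p)))"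
    using I unfolding power_mult_distrib by (simp add: sum.distrib N_def ring_distribs mult_ac)
  also have "(N * ((1 - \<epsilon>) * A) ^ p)\<^sup>2 = (N * A ^ (2 * p)) * (N * (1 - \<epsilon>) ^ (2 * p))"
    unfolding power_mult_distrib power_even_eq by (simp add: power2_eq_square mult_ac)
  finally show ?thesis
    using N A by (simp add: N_def R_def)
qed auto

section \<open>Digit boxes\<close>

definition digit_interval :: "nat \<Rightarrow> nat \<Rightarrow> real set" where
  "digit_interval q b = {real b / real q ..< (real b + 1) / real q}"

text \<open>Coordinate 0 regulates the volume through \<open>j\<close> and is kept apart from the
  coordinates in \<open>U\<close>, each of which has one digit prescribed. The free coordinates
  range over \<open>{0..<1}\<close>, the basic interval of length 1.\<close>

definition digit_box ::
    "nat \<Rightarrow> nat \<Rightarrow> nat \<Rightarrow> nat \<Rightarrow> nat set \<Rightarrow> (nat \<Rightarrow> nat) \<Rightarrow> (nat \<Rightarrow> real) set" where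
  "digit_box d q j a U g = (\<Pi>\<^sub>E i\<in>{..<d}.
     if i = 0 then {real a / real q ^ j ..< (real a + 1) / real q ^ j}
     else if i \<in> U then digit_interval q (g i) else {0..<1})"

lemma basic_intervalI:
  assumes "2 \<le> q" "a < q ^ j"
  shows "basic_interval q {real a / real q ^ j ..< (real a + 1) / real q ^ j}"
proof -
  have "real a + 1 \<le> real q ^ j"
    using assms by (metis Suc_leI of_nat_Suc of_nat_le_iff of_nat_power add.commute)
  hence "(real a + 1) / real q ^ j \<le> 1"
    using assms by (simp add: divide_simps)
  moreover have "0 \<le> real a / real q ^ j" by simp
  ultimately have "{real a / real q ^ j ..< (real a + 1) / real q ^ j} \<subseteq> {0..1}"
    by (meson atLeastAtMost_iff atLeastLessThan_iff dual_order.trans less_eq_real_def subsetI)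
  thus ?thesis unfolding basic_interval_def by blast
qed

lemma basic_box_digit_box:
  assumes "2 \<le> q" "a < q ^ j" "\<And>i. i \<in> U \<Longrightarrow> g i < q"
  shows "basic_box d q (digit_box d q j a U g)"
proof -
  have "basic_interval q {0..<1}"
    using basic_intervalI[of q 0 0] assms by simp
  moreover have "basic_interval q (digit_interval q (g i))" if "i \<in> U" for i
    using basic_intervalI[of q "g i" 1] assms that by (simp add: digit_interval_def)
  ultimately show ?thesis
    unfolding basic_box_def digit_box_def using basic_intervalI[OF assms(1,2)]
    by (intro exI conjI refl) auto
qed

lemma box_volume_digit_box:
  assumes "1 \<le> d" "2 \<le> q" "U \<subseteq> {1..<d}"
  shows "box_volume d (digit_box d q j a U g) = 1 / real q ^ (j + card U)"
proof -
  interpret product_sigma_finite "\<lambda>_::nat. lborel :: real measure"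
    by unfold_locales
  let ?E = "\<lambda>i. if i = 0 then {real a / real q ^ j ..< (real a + 1) / real q ^ j}
     else if i \<in> U then digit_interval q (g i) else {0..<1}"
  let ?l = "\<lambda>i. if i = 0 then 1 / real q ^ j else if i \<in> U then 1 / real q else 1"
  have l: "emeasure lborel (?E i) = ennreal (?l i)" for i
    using assms(2) by (auto simp: digit_interval_def divide_right_mono diff_divide_distrib[symmetric])
  have d: "{..<d} = insert 0 {1..<d}" using assms(1) by auto
  have "emeasure (\<Pi>\<^sub>M i\<in>{..<d}. lborel) (digit_box d q j a U g) =
      (\<Prod>i<d. emeasure lborel (?E i))"
    unfolding digit_box_def by (rule emeasure_PiM) (auto simp: digit_interval_def)
  also have "\<dots> = ennreal (\<Prod>i<d. ?l i)"
    unfolding l by (rule prod_ennreal) auto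
  also have "(\<Prod>i<d. ?l i) = 1 / real q ^ j * (\<Prod>i\<in>{1..<d}. if i \<in> U then 1 / real q else 1)"
    unfolding d by (subst prod.insert) (auto intro!: prod.cong)
  also have "(\<Prod>i\<in>{1..<d}. if i \<in> U then 1 / real q else 1) = (\<Prod>i\<in>U. 1 / real q)"
    using assms(3) by (simp add: prod.If_cases Int_absorb1)
  also have "1 / real q ^ j * (\<Prod>i\<in>U. 1 / real q) = 1 / real q ^ (j + card U)"
    by (simp add: power_add power_divide)
  finally show ?thesis
    by (simp add: box_volume_def measure_def)
qed

lemma mem_digit_box:
  assumes "1 \<le> d"
  shows "x \<in> digit_box d q j a U g \<longleftrightarrow> x \<in> extensional {..<d} \<and>
    real a / real q ^ j \<le> x 0 \<and> x 0 < (real a + 1) / real q ^ j \<and>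
    (\<forall>i\<in>{1..<d}. x i \<in> (if i \<in> U then digit_interval q (g i) else {0..<1}))"
proof -
  have "{..<d} = insert 0 {1..<d}" using assms by auto
  thus ?thesis
    unfolding digit_box_def PiE_iff by (simp only: ball_simps) auto
qed

text \<open>Only coordinate 0 is refined, by \<open>s\<close> further digits. Choosing
  \<open>s\<close> so that the pieces have volume \<open>1 / real q ^ n\<close> brings larger boxes
  within reach of the net property.\<close>

lemma digit_box_split:
  assumes "2 \<le> q" "1 \<le> d"
  shows "digit_box d q j 0 U g = (\<Union>a<q ^ s. digit_box d q (j + s) a U g)" (is "?L = ?R")
proof -
  have "x < 1 / real q ^ j \<and> 0 \<le> x \<longleftrightarrow>
      (\<exists>a<q ^ s. real a / real q ^ (j + s) \<le> x \<and> x < (real a + 1) / real q ^ (j + s))" for x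
  proof
    assume x: "x < 1 / real q ^ j \<and> 0 \<le> x"
    \<comment> \<open>The number formed by the first \<open>j + s\<close> digits of
      \<open>x\<close>; it is below \<open>q ^ s\<close> because the first \<open>j\<close> of them
      vanish.\<close>
    define a where "a = nat \<lfloor>x * real q ^ (j + s)\<rfloor>"
    have "real a = \<lfloor>x * real q ^ (j + s)\<rfloor>" using x by (simp add: a_def)
    hence a: "real a \<le> x * real q ^ (j + s)" "x * real q ^ (j + s) < real a + 1"
      by linarith+
    have "x * real q ^ (j + s) < real q ^ s"
      using x assms by (simp add: power_add field_simps)
    with a(1) have "real a < real q ^ s" by linarith
    hence "a < q ^ s" by (metis of_nat_less_iff of_nat_power)
    with a show "\<exists>a<q ^ s. real a / real q ^ (j + s) \<le> x \<and> x < (real a + 1) / real q ^ (j + s)"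
      using assms by (auto simp: field_simps)
  next
    assume "\<exists>a<q ^ s. real a / real q ^ (j + s) \<le> x \<and> x < (real a + 1) / real q ^ (j + s)"
    then obtain a where a: "a < q ^ s" "real a / real q ^ (j + s) \<le> x"
      "x < (real a + 1) / real q ^ (j + s)" by blast
    have "real a + 1 \<le> real q ^ s"
      using a(1) by (metis Suc_leI of_nat_Suc of_nat_le_iff of_nat_power add.commute)
    hence "(real a + 1) / real q ^ (j + s) \<le> real q ^ s / real q ^ (j + s)"
      by (intro divide_right_mono) auto
    also have "\<dots> = 1 / real q ^ j" using assms by (simp add: power_add)
    finally show "x < 1 / real q ^ j \<and> 0 \<le> x"
      using a by (auto intro: order_trans[rotated])
  qed
  from this[of "x 0" for x] show ?thesis
    by (auto simp: mem_digit_box[OF assms(2)] set_eq_iff)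
qed

lemma digit_box_disjoint:
  assumes "2 \<le> q" "1 \<le> d" "a \<noteq> b"
  shows "digit_box d q j a U g \<inter> digit_box d q j b U g = {}"
proof -
  have False if "x \<in> digit_box d q j a U g" "x \<in> digit_box d q j b U g" for x
  proof -
    have "real a \<le> x 0 * real q ^ j" "x 0 * real q ^ j < real a + 1"
      "real b \<le> x 0 * real q ^ j" "x 0 * real q ^ j < real b + 1"
      using that assms(1) by (simp_all add: mem_digit_box[OF assms(2)] field_simps)
    with assms(3) show False by linarith
  qed
  thus ?thesis by blast
qed

section \<open>Point counts and characters on a slice of the net\<close>

locale net_slice =
  fixes d q n k :: nat and m \<epsilon> :: real and P :: "(nat \<Rightarrow> real) set"
  assumes d: "1 \<le> d" and q: "2 \<le> q" and m: "0 < m" and net: "almost_net d q n m \<epsilon> P"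
    and kn: "2 * k \<le> n"
begin

lemma finite_P: "finite P"
  using net by (simp add: almost_net_def)

text \<open>The box is cut along coordinate 0 into pieces of volume \<open>1 / real q ^ n\<close>,
  each holding \<open>m\<close> points up to an error \<open>\<epsilon> * m\<close>. The errors add
  up, so the relative error stays \<epsilon>.\<close>

lemma card_digit_box:
  assumes U: "U \<subseteq> {1..<d}" and j: "j + card U \<le> n" and g: "\<And>i. i \<in> U \<Longrightarrow> g i < q"
  shows "\<bar>real (card (digit_box d q j 0 U g \<inter> P)) - m * real q ^ (n - (j + card U))\<bar> \<le>
    \<epsilon> * (m * real q ^ (n - (j + card U)))"
proof -
  define s where "s = n - (j + card U)"
  have "card (digit_box d q j 0 U g \<inter> P) = card (\<Union>a<q ^ s. digit_box d q (j + s) a U g \<inter> P)"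
    by (subst digit_box_split[OF q d, of j U g s]) simp
  also have "\<dots> = (\<Sum>a<q ^ s. card (digit_box d q (j + s) a U g \<inter> P))"
    using finite_P digit_box_disjoint[OF q d] by (intro card_UN_disjoint) blast+
  finally have "\<bar>real (card (digit_box d q j 0 U g \<inter> P)) - m * real q ^ s\<bar> =
      \<bar>\<Sum>a<q ^ s. (real (card (digit_box d q (j + s) a U g \<inter> P)) - m)\<bar>"
    by (simp add: sum_subtractf mult.commute)
  also have "\<dots> \<le> (\<Sum>a<q ^ s. \<epsilon> * m)"
  proof (intro order_trans[OF sum_abs] sum_mono)
    fix a assume "a \<in> {..<q ^ s}"
    have "a < q ^ (j + s)"
    proof -
      have "q ^ s \<le> q ^ (j + s)" using q by (intro power_increasing) auto
      thus ?thesis using \<open>a \<in> {..<q ^ s}\<close> by simp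
    qed
    hence "basic_box d q (digit_box d q (j + s) a U g)"
      using g by (intro basic_box_digit_box q)
    moreover have "box_volume d (digit_box d q (j + s) a U g) = 1 / real q ^ n"
      using box_volume_digit_box[OF d q U, of "j + s" a g] j by (simp add: s_def)
    ultimately have "(1 - \<epsilon>) * m \<le> real (card (digit_box d q (j + s) a U g \<inter> P))"
      "real (card (digit_box d q (j + s) a U g \<inter> P)) \<le> (1 + \<epsilon>) * m"
      using net unfolding almost_net_def by blast+
    thus "\<bar>real (card (digit_box d q (j + s) a U g \<inter> P)) - m\<bar> \<le> \<epsilon> * m"
      by (simp add: abs_le_iff algebra_simps)
  qed
  finally show ?thesis by (simp add: s_def mult_ac)
qed

text \<open>The definition of an almost net imposes no sign on \<epsilon>; the sign follows because
  \<open>\<epsilon> * (m * real q ^ n)\<close> bounds an absolute value.\<close>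

lemma eps_nonneg: "0 \<le> \<epsilon>"
proof -
  have "0 \<le> \<epsilon> * (m * real q ^ n)"
    using card_digit_box[of "{}" 0 "\<lambda>_. 0"] by simp
  moreover have "0 < m * real q ^ n" using m q by simp
  ultimately show ?thesis by (simp add: zero_le_mult_iff)
qed

text \<open>The \<open>n - 2 * k\<close> digits spent on coordinate 0 leave a budget of
  \<open>2 * k\<close> digits for the other coordinates, just enough for two \<open>k\<close>-sets
  of them.\<close>

definition slice :: "(nat \<Rightarrow> real) set" where
  "slice = digit_box d q (n - 2 * k) 0 {} (\<lambda>_. 0) \<inter> P"

lemma finite_slice: "finite slice"
  using finite_P by (simp add: slice_def)

lemma card_slice: "\<bar>real (card slice) - m * real q ^ (2 * k)\<bar> \<le> \<epsilon> * (m * real q ^ (2 * k))"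
  using card_digit_box[of "{}" "n - 2 * k" "\<lambda>_. 0"] kn by (simp add: slice_def)

lemma slice_digits:
  assumes "U \<subseteq> {1..<d}" "\<And>i. i \<in> U \<Longrightarrow> g i < q"
  shows "{x \<in> slice. \<forall>i\<in>U. x i \<in> digit_interval q (g i)} = digit_box d q (n - 2 * k) 0 U g \<inter> P"
proof -
  have "digit_interval q (g i) \<subseteq> {0..<1}" if "i \<in> U" for i
  proof -
    have "real (g i) + 1 \<le> real q" using assms(2)[OF that] by simp
    thus ?thesis using q by (auto simp: digit_interval_def field_simps)
  qed
  moreover have "i \<in> {1..<d}" if "i \<in> U" for i using assms(1) that by blast
  ultimately have key: "(\<forall>i\<in>{1..<d}. x i \<in> (if i \<in> U then digit_interval q (g i) else {0..<1})) \<longleftrightarrow>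
      (\<forall>i\<in>{1..<d}. x i \<in> {0..<1}) \<and> (\<forall>i\<in>U. x i \<in> digit_interval q (g i))" for x
    by (simp only: if_split_mem2) blast
  show ?thesis
    unfolding slice_def set_eq_iff Int_iff mem_Collect_eq mem_digit_box[OF d] key by auto
qed

lemma card_slice_digits:
  assumes "U \<subseteq> {1..<d}" "card U \<le> 2 * k" "\<And>i. i \<in> U \<Longrightarrow> g i < q"
  shows "\<bar>real (card {x \<in> slice. \<forall>i\<in>U. x i \<in> digit_interval q (g i)}) -
    m * real q ^ (2 * k - card U)\<bar> \<le> \<epsilon> * (m * real q ^ (2 * k - card U))"
  using card_digit_box[of U "n - 2 * k" g] assms kn
  by (simp add: slice_digits)

text \<open>Expanding the product over all choices of digits 0 or 1 on \<open>U\<close> gives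
  \<open>2 ^ card U\<close> box counts with weights of modulus at most 1, each count with relative
  error \<epsilon>. General weights are allowed because a product of two characters has squared
  factors on some coordinates and plain ones on others.\<close>

lemma slice_product_sum:
  assumes U: "U \<subseteq> {1..<d}" "card U \<le> 2 * k" and s: "\<And>i b. \<bar>s i b\<bar> \<le> (1::real)"
  shows "\<bar>(\<Sum>x\<in>slice. \<Prod>i\<in>U. \<Sum>b<2. s i b * indicator (digit_interval q b) (x i)) -
    m * real q ^ (2 * k - card U) * (\<Prod>i\<in>U. \<Sum>b<2. s i b)\<bar> \<le>
    \<epsilon> * (m * real q ^ (2 * k - card U) * 2 ^ card U)"
proof -
  define G where "G = PiE U (\<lambda>_. {..<2::nat})"
  define N where "N g = real (card {x \<in> slice. \<forall>i\<in>U. x i \<in> digit_interval q (g i)})" for g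
  define M where "M = m * real q ^ (2 * k - card U)"
  have fU: "finite U" using U finite_subset by blast
  have ind: "(\<Prod>i\<in>U. indicator (digit_interval q (g i)) (x i)) =
      (of_bool (\<forall>i\<in>U. x i \<in> digit_interval q (g i)) :: real)" for x :: "nat \<Rightarrow> real" and g
    using fU by (induction U) auto
  have "(\<Sum>x\<in>slice. \<Prod>i\<in>U. \<Sum>b<2. s i b * indicator (digit_interval q b) (x i)) =
      (\<Sum>x\<in>slice. \<Sum>g\<in>G. (\<Prod>i\<in>U. s i (g i)) * of_bool (\<forall>i\<in>U. x i \<in> digit_interval q (g i)))"
    unfolding G_def by (subst prod_sum_PiE[OF fU]) (simp_all add: prod.distrib ind)
  also have "\<dots> = (\<Sum>g\<in>G. (\<Prod>i\<in>U. s i (g i)) * N g)"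
    using finite_slice by (subst sum.swap) (simp add: N_def sum_distrib_left[symmetric] Int_def)
  finally have "(\<Sum>x\<in>slice. \<Prod>i\<in>U. \<Sum>b<2. s i b * indicator (digit_interval q b) (x i)) -
      M * (\<Prod>i\<in>U. \<Sum>b<2. s i b) = (\<Sum>g\<in>G. (\<Prod>i\<in>U. s i (g i)) * (N g - M))"
    unfolding G_def
    by (subst prod_sum_PiE[OF fU]) (simp_all add: algebra_simps sum_distrib_left sum_subtractf)
  also have "\<bar>\<dots>\<bar> \<le> (\<Sum>g\<in>G. \<epsilon> * M)"
  proof (intro order_trans[OF sum_abs] sum_mono)
    fix g assume "g \<in> G"
    hence "g i < q" if "i \<in> U" for i
      using PiE_mem[of g U "\<lambda>_. {..<2}" i] that q by (auto simp: G_def)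
    hence "\<bar>N g - M\<bar> \<le> \<epsilon> * M"
      unfolding N_def M_def by (intro card_slice_digits U)
    moreover have "\<bar>\<Prod>i\<in>U. s i (g i)\<bar> \<le> 1"
      unfolding abs_prod using s by (intro prod_le_1) auto
    ultimately have "\<bar>\<Prod>i\<in>U. s i (g i)\<bar> * \<bar>N g - M\<bar> \<le> 1 * (\<epsilon> * M)"
      by (intro mult_mono) auto
    thus "\<bar>(\<Prod>i\<in>U. s i (g i)) * (N g - M)\<bar> \<le> \<epsilon> * M" by (simp add: abs_mult)
  qed
  also have "\<dots> = \<epsilon> * (M * 2 ^ card U)"
    using fU by (simp add: G_def card_PiE)
  finally show ?thesis by (simp add: M_def)
qed

text \<open>For \<open>q = 2\<close> these are Walsh functions of the first digits. For larger
  \<open>q\<close> the digits from 2 on are sent to 0, which keeps the mean of each factor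
  zero.\<close>

definition character :: "nat set \<Rightarrow> (nat \<Rightarrow> real) \<Rightarrow> real" where
  "character T x = (\<Prod>i\<in>T. indicator (digit_interval q 0) (x i) - indicator (digit_interval q 1) (x i))"

text \<open>Each coordinate in the symmetric difference of \<open>S\<close> and \<open>T\<close>
  contributes a factor with digit sum \<open>1 - 1 = 0\<close>, so the main term survives only for
  \<open>S = T\<close>. There every factor is a square with digit sum 2.\<close>

lemma character_inner:
  assumes S: "S \<subseteq> {1..<d}" "card S = k" and T: "T \<subseteq> {1..<d}" "card T = k"
  shows "\<bar>(\<Sum>x\<in>slice. character S x * character T x) - (if S = T then m * (2 * real q) ^ k else 0)\<bar> \<le>
    \<epsilon> * (m * (2 * real q) ^ k)"
proof -
  \<comment> \<open>On \<open>S \<inter> T\<close> the factor is squared, so digit 1 gets weight 1;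
    elsewhere it keeps its sign.\<close>
  define s where "s i b = (if i \<in> S \<inter> T \<or> b = 0 then 1 else - 1 :: real)" for i and b :: nat
  define U where "U = S \<union> T"
  have fin: "finite S" "finite T" using S T finite_subset by blast+
  have U: "U \<subseteq> {1..<d}" "card U \<le> 2 * k"
    using S T card_Un_le[of S T] by (auto simp: U_def)
  have disj: "digit_interval q 0 \<inter> digit_interval q 1 = {}"
    by (auto simp: digit_interval_def)
  have kU: "k \<le> card U" using S(2) fin by (metis U_def card_mono finite_Un sup_ge1)
  have "character S x * character T x = (\<Prod>i\<in>U. \<Sum>b<2. s i b * indicator (digit_interval q b) (x i))" for x
  proof -
    let ?f = "\<lambda>i. indicator (digit_interval q 0) (x i) - indicator (digit_interval q 1) (x i) :: real"
    have "character S x = (\<Prod>i\<in>U. if i \<in> S then ?f i else 1)"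
      unfolding character_def using fin by (simp add: prod.If_cases U_def Int_absorb1)
    moreover have "character T x = (\<Prod>i\<in>U. if i \<in> T then ?f i else 1)"
      unfolding character_def using fin by (simp add: prod.If_cases U_def Int_absorb1)
    ultimately have "character S x * character T x =
        (\<Prod>i\<in>U. (if i \<in> S then ?f i else 1) * (if i \<in> T then ?f i else 1))"
      by (simp add: prod.distrib)
    also have "\<dots> = (\<Prod>i\<in>U. \<Sum>b<2. s i b * indicator (digit_interval q b) (x i))"
      using disj by (intro prod.cong refl)
        (auto simp: s_def U_def numeral_2_eq_2 indicator_def)
    finally show ?thesis .
  qed
  hence "\<bar>(\<Sum>x\<in>slice. character S x * character T x) -
      m * real q ^ (2 * k - card U) * (\<Prod>i\<in>U. \<Sum>b<2. s i b)\<bar> \<le>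
      \<epsilon> * (m * real q ^ (2 * k - card U) * 2 ^ card U)"
    using slice_product_sum[OF U, of s] by (simp add: s_def)
  moreover have "m * real q ^ (2 * k - card U) * (\<Prod>i\<in>U. \<Sum>b<2. s i b) =
      (if S = T then m * (2 * real q) ^ k else 0)"
  proof (cases "S = T")
    case True
    thus ?thesis using S by (simp add: s_def U_def numeral_2_eq_2 power_mult_distrib)
  next
    case False
    hence "U - S \<inter> T \<noteq> {}" by (auto simp: U_def)
    then obtain i where i: "i \<in> U" "i \<notin> S \<inter> T" by blast
    have "(\<Sum>b<2. s i b) = 0" using i by (simp add: s_def numeral_2_eq_2)
    hence "(\<Prod>i\<in>U. \<Sum>b<2. s i b) = 0" using i(1) fin by (auto simp: U_def)
    thus ?thesis using False by simp
  qed
  \<comment> \<open>Beyond the first \<open>k\<close> elements, each element of \<open>U\<close>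
    trades a factor \<open>q\<close> for a factor 2, so the error is largest for
    \<open>card U = k\<close>. This makes all errors comparable to the common diagonal
    value.\<close>
  moreover have "real q ^ (2 * k - card U) * 2 ^ card U \<le> (2 * real q) ^ k"
  proof -
    have "real q ^ (2 * k - card U) * 2 ^ card U =
        real q ^ (2 * k - card U) * 2 ^ (card U - k) * 2 ^ k"
      using kU by (simp add: power_add[symmetric])
    also have "\<dots> \<le> real q ^ (2 * k - card U) * real q ^ (card U - k) * 2 ^ k"
      using q by (intro mult_right_mono mult_left_mono power_mono) auto
    also have "\<dots> = (2 * real q) ^ k"
      using kU U(2) by (simp add: power_add[symmetric] power_mult_distrib mult.commute)
    finally show ?thesis .
  qed
  hence "\<epsilon> * (m * real q ^ (2 * k - card U) * 2 ^ card U) \<le> \<epsilon> * (m * (2 * real q) ^ k)"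
    using eps_nonneg m by (simp add: mult.assoc mult_left_mono)
  ultimately show ?thesis by linarith
qed

text \<open>The vectors are the characters of the \<open>k\<close>-subsets of
  \<open>{1..<d}\<close>; coordinate 0 is reserved for the slice, whence
  \<open>d - 1\<close>.\<close>

lemma choose_bound:
  assumes "\<epsilon> \<le> 1"
  shows "real ((d - 1) choose k) * (1 - \<epsilon>) ^ (2 * p) \<le>
    real ((card slice + p - 1) choose p) *
      ((1 + \<epsilon>) ^ (2 * p) + real ((d - 1) choose k) * \<epsilon> ^ (2 * p))"
proof -
  define I where "I = {T. T \<subseteq> {1..<d} \<and> card T = k}"
  have I: "finite I" "card I = (d - 1) choose k"
    unfolding I_def using n_subsets[of "{1..<d}" k] by simp_all
  have "0 < m * (2 * real q) ^ k" using m q by simp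
  note bound = near_orthogonal_card_bound[OF finite_slice I(1) this eps_nonneg assms, of character p]
  have diag: "\<bar>(\<Sum>x\<in>slice. (character T x)\<^sup>2) - m * (2 * real q) ^ k\<bar> \<le> \<epsilon> * (m * (2 * real q) ^ k)"
    if "T \<in> I" for T
    using character_inner[of T T] that by (simp add: I_def power2_eq_square)
  have off: "\<bar>\<Sum>x\<in>slice. character S x * character T x\<bar> \<le> \<epsilon> * (m * (2 * real q) ^ k)"
    if "S \<in> I" "T \<in> I" "S \<noteq> T" for S T
    using character_inner[of S T] that by (simp add: I_def)
  show ?thesis
    unfolding I(2)[symmetric] by (rule bound) (fact diag off)+
qed

text \<open>For \<open>\<epsilon> < 1\<close> any two coordinates are told apart by a point of the slice.\<close>
lemma pow2_card_slice:
  assumes "\<epsilon> < 1" "1 \<le> k"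
  shows "d - 1 \<le> 2 ^ card slice"
proof -
  define Z where "Z i = {x \<in> slice. x i \<in> digit_interval q 0}" for i
  have "inj_on Z {1..<d}"
  proof (rule inj_onI, rule ccontr)
    fix i j assume ij: "i \<in> {1..<d}" "j \<in> {1..<d}" "Z i = Z j" "i \<noteq> j"
    \<comment> \<open>The box with digit 0 at \<open>i\<close> and digit 1 at \<open>j\<close> uses
      two digits, which the slice affords as \<open>1 \<le> k\<close>. Since
      \<open>\<epsilon> < 1\<close> it contains a point, and this point lies in \<open>Z i\<close>
      but not in \<open>Z j\<close>.\<close>
    define g where "g = (\<lambda>l. if l = i then 0 else 1 :: nat)"
    have "\<bar>real (card {x \<in> slice. \<forall>l\<in>{i, j}. x l \<in> digit_interval q (g l)}) -
        m * real q ^ (2 * k - card {i, j})\<bar> \<le> \<epsilon> * (m * real q ^ (2 * k - card {i, j}))"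
      using ij assms q by (intro card_slice_digits) (auto simp: g_def)
    moreover have "\<epsilon> * (m * real q ^ (2 * k - card {i, j})) < 1 * (m * real q ^ (2 * k - card {i, j}))"
      using assms m q by (intro mult_strict_right_mono) auto
    ultimately have "card {x \<in> slice. \<forall>l\<in>{i, j}. x l \<in> digit_interval q (g l)} \<noteq> 0"
      by (auto simp del: card_eq_0_iff)
    then obtain x where "x \<in> slice" "x i \<in> digit_interval q 0" "x j \<in> digit_interval q 1"
      using ij(4) by (auto simp: g_def dest!: card_gt_0_iff[THEN iffD1] simp: card_eq_0_iff)
    moreover from this have "x j \<notin> digit_interval q 0" by (auto simp: digit_interval_def)
    ultimately show False using ij(3) by (auto simp: Z_def)
  qed
  hence "card {1..<d} \<le> card (Pow slice)"
    by (rule card_inj_on_le) (auto simp: Z_def finite_slice)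
  thus ?thesis by (simp add: card_Pow finite_slice)
qed

lemma card_slice_pos:
  assumes "\<epsilon> < 1"
  shows "1 \<le> card slice"
proof -
  have "\<epsilon> * (m * real q ^ (2 * k)) < 1 * (m * real q ^ (2 * k))"
    using assms m q by (intro mult_strict_right_mono) auto
  with card_slice have "card slice \<noteq> 0" by (auto simp del: card_eq_0_iff)
  thus ?thesis by simp
qed

lemma card_slice_le:
  assumes "\<epsilon> \<le> 1"
  shows "real (card slice) \<le> 2 * m * real q ^ (2 * k)"
proof -
  have "\<epsilon> * (m * real q ^ (2 * k)) \<le> 1 * (m * real q ^ (2 * k))"
    using assms m q by (intro mult_right_mono) auto
  with card_slice show ?thesis by linarith
qed

end

section \<open>Lower bounds\<close>

text \<open>A single term of the exponential series at \<open>p\<close> is at most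
  \<open>exp p\<close>, and \<open>exp 1 \<le> 3\<close>.\<close>

lemma power_self_le_fact: "real p ^ p \<le> 3 ^ p * fact p"
proof -
  have "real p ^ p /\<^sub>R fact p \<le> (\<Sum>n. real p ^ n /\<^sub>R fact n)"
    using sum_le_suminf[OF summable_exp_generic[of "real p"], of "{p}"] by simp
  also have "\<dots> = exp (real p)" by (simp add: exp_def)
  also have "\<dots> = exp 1 ^ p" using exp_of_nat_mult[of p "1 :: real"] by simp
  also have "\<dots> \<le> 3 ^ p" using exp_le by (intro power_mono) auto
  finally show ?thesis by (simp add: divide_simps mult.commute)
qed

text \<open>The bound is shaped as a pure \<open>p\<close>-th power so that a \<open>p\<close>-th
  root can be taken in \<open>tensor_power_bound\<close>.\<close>

lemma choose_le_power:
  assumes "1 \<le> p"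
  shows "real ((M + p - 1) choose p) \<le> (3 * (real M + real p) / real p) ^ p"
proof -
  have "((M + p - 1) choose p) * fact p \<le> (M + p) ^ p"
    by (rule order_trans[OF binomial_fact_pow]) (auto intro: power_mono)
  hence "real (((M + p - 1) choose p) * fact p) \<le> real ((M + p) ^ p)" by (simp only: of_nat_le_iff)
  hence *: "real ((M + p - 1) choose p) * fact p \<le> (real M + real p) ^ p" by simp
  have "real ((M + p - 1) choose p) * real p ^ p \<le> real ((M + p - 1) choose p) * (3 ^ p * fact p)"
    by (intro mult_left_mono power_self_le_fact) auto
  also have "\<dots> \<le> 3 ^ p * (real M + real p) ^ p"
    using mult_left_mono[OF *, of "3 ^ p"] by (simp add: mult_ac)
  also have "\<dots> = (3 * (real M + real p)) ^ p" by (rule power_mult_distrib[symmetric])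
  finally show ?thesis
    using assms by (simp add: power_divide pos_le_divide_eq)
qed

section \<open>Lower bounds for the size of a slice\<close>

context net_slice
begin

text \<open>The case \<open>p = 1\<close> of \<open>choose_bound\<close>, multiplied by
  \<open>\<epsilon>\<^sup>2\<close>, yields
  \<open>y / (9 + 4 * y) \<le> M * \<epsilon>\<^sup>2\<close>. The left side increases with
  \<open>y\<close>, so a lower bound \<open>c\<close> for \<open>y\<close> suffices; passing from
  \<open>M\<close> to \<open>m\<close> doubles the denominator.\<close>

lemma single_power_bound:
  assumes e: "\<epsilon> \<le> 1 / 2" and c: "0 \<le> c" "c \<le> real ((d - 1) choose k) * \<epsilon>\<^sup>2"
  shows "c / (18 + 8 * c) \<le> m * real q ^ (2 * k) * \<epsilon>\<^sup>2"
proof -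
  define N M y where "N = real ((d - 1) choose k)" and "M = real (card slice)" and "y = N * \<epsilon>\<^sup>2"
  have M: "0 \<le> M" "M \<le> 2 * m * real q ^ (2 * k)"
    using card_slice_le e by (auto simp: M_def)
  have y: "c \<le> y" using c by (simp add: y_def N_def)
  have "N * (1 / 2)\<^sup>2 \<le> N * (1 - \<epsilon>)\<^sup>2"
    using e by (intro mult_left_mono power_mono) (auto simp: N_def)
  also have "\<dots> \<le> M * ((1 + \<epsilon>)\<^sup>2 + y)"
    using choose_bound[of 1] e by (simp add: N_def M_def y_def)
  also have "\<dots> \<le> M * ((3 / 2)\<^sup>2 + y)"
    using e eps_nonneg M by (intro mult_left_mono add_right_mono power_mono) auto
  finally have "N * (1 / 2)\<^sup>2 * \<epsilon>\<^sup>2 \<le> M * ((3 / 2)\<^sup>2 + y) * \<epsilon>\<^sup>2"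
    by (rule mult_right_mono) auto
  hence "y \<le> (M * \<epsilon>\<^sup>2) * (9 + 4 * y)"
    by (simp add: y_def power2_eq_square algebra_simps)
  hence My: "y / (9 + 4 * y) \<le> M * \<epsilon>\<^sup>2" using y c by (simp add: divide_simps)
  have "c / (18 + 8 * c) = 1 / 2 * (c / (9 + 4 * c))" using c by (simp add: field_simps)
  also have "c / (9 + 4 * c) \<le> y / (9 + 4 * y)"
    using y c by (simp add: divide_simps) (simp add: algebra_simps)
  also note My
  also have "M * \<epsilon>\<^sup>2 \<le> 2 * (m * real q ^ (2 * k) * \<epsilon>\<^sup>2)"
    using mult_right_mono[OF M(2), of "\<epsilon>\<^sup>2"] by (simp add: mult_ac)
  finally show ?thesis by simp
qed

text \<open>The hypothesis on \<open>\<epsilon> ^ (2 * p)\<close> keeps the diagonal contribution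
  within a constant factor, up to \<open>(1 + \<epsilon>) ^ (2 * p)\<close>, of the off-diagonal
  one. The binomial coefficient must then be about \<open>\<epsilon> ^ (- 2 p)\<close> up to a
  factor exponential in \<open>p\<close>, and a \<open>p\<close>-th root bounds
  \<open>card slice\<close>.\<close>

lemma tensor_power_bound:
  assumes k: "k = 1" and p: "1 \<le> p" and d2: "2 \<le> d" and e: "0 < \<epsilon>" "\<epsilon> \<le> 1 / 16"
    and N: "1 \<le> 8 * real (d - 1) * \<epsilon> ^ (2 * p)"
  shows "real p / 64 \<le> real (card slice) * \<epsilon>\<^sup>2"
proof -
  define N R M where "N = real (d - 1)" and "R = real ((card slice + p - 1) choose p)"
    and "M = real (card slice)"
  have N0: "N > 0" using d2 by (simp add: N_def)
  have R0: "R \<ge> 0" by (simp add: R_def)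
  have "N * (1 - \<epsilon>) ^ (2 * p) \<le> R * ((1 + \<epsilon>) ^ (2 * p) + N * \<epsilon> ^ (2 * p))"
    using choose_bound[of p] e k by (simp add: N_def R_def)
  also have "\<dots> \<le> R * ((1 + \<epsilon>) ^ (2 * p) * (9 * N * \<epsilon> ^ (2 * p)))"
  proof (intro mult_left_mono R0)
    have "1 \<le> (1 + \<epsilon>) ^ (2 * p)" using e by simp
    hence "(1 + \<epsilon>) ^ (2 * p) * 1 + 1 * (N * \<epsilon> ^ (2 * p)) \<le>
        (1 + \<epsilon>) ^ (2 * p) * (8 * N * \<epsilon> ^ (2 * p)) + (1 + \<epsilon>) ^ (2 * p) * (N * \<epsilon> ^ (2 * p))"
      using N N0 e by (intro add_mono mult_left_mono mult_right_mono) (auto simp: N_def)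
    thus "(1 + \<epsilon>) ^ (2 * p) + N * \<epsilon> ^ (2 * p) \<le> (1 + \<epsilon>) ^ (2 * p) * (9 * N * \<epsilon> ^ (2 * p))"
      by (simp add: algebra_simps)
  qed
  finally have "N * (1 - \<epsilon>) ^ (2 * p) \<le> N * (9 * R * ((1 + \<epsilon>) * \<epsilon>) ^ (2 * p))"
    unfolding power_mult_distrib by (simp add: mult_ac)
  hence *: "(1 - \<epsilon>) ^ (2 * p) \<le> 9 * R * ((1 + \<epsilon>) * \<epsilon>) ^ (2 * p)" using N0 by simp
  \<comment> \<open>\<open>15 / 17\<close> is the value of
    \<open>(1 - \<epsilon>) / (1 + \<epsilon>)\<close> at \<open>\<epsilon> = 1 / 16\<close>; its
    square exceeds \<open>3 / 4\<close>.\<close>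
  have "(1 + \<epsilon>) * (15 / 17) \<le> 1 - \<epsilon>" using e by simp
  hence "((1 + \<epsilon>) * (15 / 17)) ^ (2 * p) \<le> (1 - \<epsilon>) ^ (2 * p)"
    using e by (intro power_mono) auto
  also note *
  also have "9 * R * ((1 + \<epsilon>) * \<epsilon>) ^ (2 * p) = (1 + \<epsilon>) ^ (2 * p) * (9 * R * \<epsilon> ^ (2 * p))"
    unfolding power_mult_distrib by (simp add: mult_ac)
  finally have "(15 / 17) ^ (2 * p) \<le> 9 * R * \<epsilon> ^ (2 * p)"
    unfolding power_mult_distrib using e by simp
  moreover have "(3 / 4 :: real) ^ p \<le> ((15 / 17)\<^sup>2) ^ p"
    by (intro power_mono) (auto simp: power2_eq_square)
  ultimately have "(3 / 4) ^ p \<le> 9 * R * (\<epsilon>\<^sup>2) ^ p" by (simp add: power_mult)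
  \<comment> \<open>The constant 9 is weakened to \<open>9 ^ p\<close> so that every factor is a
    \<open>p\<close>-th power.\<close>
  also have "\<dots> \<le> 9 ^ p * R * (\<epsilon>\<^sup>2) ^ p"
    using p R0 by (intro mult_right_mono self_le_power) auto
  also have "\<dots> \<le> 9 ^ p * (3 * (M + real p) / real p) ^ p * (\<epsilon>\<^sup>2) ^ p"
    using choose_le_power[OF p, of "card slice"]
    by (intro mult_right_mono mult_left_mono) (auto simp: R_def M_def)
  also have "\<dots> = (9 * (3 * (M + real p) / real p) * \<epsilon>\<^sup>2) ^ p"
    unfolding power_mult_distrib ..
  finally have "3 / 4 \<le> 9 * (3 * (M + real p) / real p) * \<epsilon>\<^sup>2"
    using p by (subst (asm) power_mono_iff) (auto simp: M_def)
  hence "real p \<le> 36 * (M * \<epsilon>\<^sup>2) + 36 * (real p * \<epsilon>\<^sup>2)"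
    using p by (simp add: field_simps)
  \<comment> \<open>The summand \<open>p\<close> in \<open>M + p\<close> costs at most
    \<open>36 / 256\<close> of \<open>p\<close>, leaving
    \<open>55 / 64 * p \<le> 36 * M * \<epsilon>\<^sup>2\<close>.\<close>
  moreover have "\<epsilon>\<^sup>2 \<le> (1 / 16)\<^sup>2" using e by (intro power_mono) auto
  hence "real p * \<epsilon>\<^sup>2 \<le> real p * (1 / 256)"
    by (intro mult_left_mono) (auto simp: power2_eq_square)
  ultimately show ?thesis by (simp add: M_def)
qed

text \<open>Here \<open>x\<close> is the real exponent with
  \<open>\<epsilon> ^ (2 x) = 1 / d\<close>, and \<open>p\<close> is its integer part, but at least
  1. As \<open>p \<ge> x / 2\<close>, \<open>tensor_power_bound\<close> applies with a loss of only
  a constant.\<close>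

lemma ln_dim_bound_small_eps:
  assumes k: "k = 1" and d2: "2 \<le> d" and e: "1 / (2 * sqrt (real d)) \<le> \<epsilon>" "\<epsilon> \<le> 1 / 16"
  shows "ln (real d) / 256 \<le> real (card slice) * \<epsilon>\<^sup>2 * ln (1 / \<epsilon>)"
proof -
  define L x p where "L = ln (1 / \<epsilon>)" and "x = ln (real d) / (2 * L)" and "p = max 1 (nat \<lfloor>x\<rfloor>)"
  have "0 < 1 / (2 * sqrt (real d))" using d2 by simp
  with e have e0: "0 < \<epsilon>" by linarith
  have L: "L > 0" using e e0 by (simp add: L_def)
  have x0: "x \<ge> 0" using L d2 by (simp add: x_def)
  have p: "1 \<le> p" "x / 2 \<le> real p" unfolding p_def using x0 by linarith+
  have N: "1 \<le> 8 * real (d - 1) * \<epsilon> ^ (2 * p)"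
  \<comment> \<open>For \<open>x < 1\<close> the choice \<open>p = 1\<close> may exceed
    \<open>x\<close>; the lower bound on \<epsilon> then gives
    \<open>\<epsilon>\<^sup>2 \<ge> 1 / (4 d)\<close>, which is enough as
    \<open>d \<ge> 2\<close>.\<close>
  proof (cases "x < 1")
    case True
    hence "\<lfloor>x\<rfloor> \<le> 0" by linarith
    hence p1: "p = 1" by (simp add: p_def)
    have "(1 / (2 * sqrt (real d)))\<^sup>2 \<le> \<epsilon>\<^sup>2"
      using e(1) by (intro power_mono) auto
    hence "1 / (4 * real d) \<le> \<epsilon>\<^sup>2" by (simp add: power_divide power_mult_distrib)
    hence "8 * real (d - 1) * (1 / (4 * real d)) \<le> 8 * real (d - 1) * \<epsilon>\<^sup>2"
      by (intro mult_left_mono) auto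
    moreover have "1 \<le> 8 * real (d - 1) * (1 / (4 * real d))"
      using d2 by (simp add: of_nat_diff field_simps)
    ultimately have "1 \<le> 8 * real (d - 1) * \<epsilon>\<^sup>2" by (rule order_trans[rotated])
    thus ?thesis by (simp only: p1 mult_1_right)
  next
    case False
    hence "real p \<le> x" unfolding p_def by linarith
    hence "2 * real p * L \<le> ln (real d)" using L by (simp add: x_def field_simps)
    hence "exp (- ln (real d)) \<le> exp (real (2 * p) * ln \<epsilon>)"
      using e0 by (simp add: L_def ln_div)
    also have "\<dots> = \<epsilon> ^ (2 * p)" using e0 by (simp only: exp_of_nat_mult exp_ln)
    finally have "1 / real d \<le> \<epsilon> ^ (2 * p)" using d2 by (simp add: exp_minus field_simps)
    hence "8 * real (d - 1) * (1 / real d) \<le> 8 * real (d - 1) * \<epsilon> ^ (2 * p)"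
      by (intro mult_left_mono) auto
    moreover have "1 \<le> 8 * real (d - 1) * (1 / real d)"
      using d2 by (simp add: of_nat_diff field_simps)
    ultimately show ?thesis by linarith
  qed
  have "ln (real d) / 256 = x / 2 / 64 * L" using L by (simp add: x_def field_simps)
  also have "\<dots> \<le> real p / 64 * L" using p L by (intro mult_right_mono) auto
  also have "\<dots> \<le> real (card slice) * \<epsilon>\<^sup>2 * L"
    using tensor_power_bound[OF k p(1) d2 e0 e(2) N] L by (intro mult_right_mono) auto
  finally show ?thesis by (simp add: L_def)
qed

text \<open>Both \<open>\<epsilon>\<^sup>2\<close> and \<open>ln (1 / \<epsilon>)\<close> are
  bounded below here, so it is enough that \<open>card slice\<close> grows like \<open>ln d\<close>,
  which \<open>pow2_card_slice\<close> provides.\<close>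

lemma ln_dim_bound_large_eps:
  assumes k: "k = 1" and d2: "2 \<le> d" and e: "1 / 16 \<le> \<epsilon>" "\<epsilon> \<le> \<epsilon>\<^sub>0" "\<epsilon>\<^sub>0 < 1"
  shows "ln (1 / \<epsilon>\<^sub>0) / 512 * ln (real d) \<le> real (card slice) * \<epsilon>\<^sup>2 * ln (1 / \<epsilon>)"
proof -
  have M1: "1 \<le> card slice" using card_slice_pos e by simp
  have "d - 1 \<le> 2 ^ card slice" using pow2_card_slice e k by simp
  hence "d \<le> 2 ^ (card slice + 1)" using d2 by simp
  hence "real d \<le> 2 ^ (card slice + 1)"
    by (metis of_nat_le_iff of_nat_numeral of_nat_power)
  hence "ln (real d) \<le> ln (2 ^ (card slice + 1))" using d2 by simp
  also have "\<dots> = real (card slice + 1) * ln 2" by (rule ln_realpow)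
  also have "\<dots> \<le> real (card slice + 1) * 1" using ln_2_less_1 by (intro mult_left_mono) auto
  finally have M: "ln (real d) / 2 \<le> real (card slice)" using M1 by simp
  have "(1 / 16)\<^sup>2 \<le> \<epsilon>\<^sup>2" using e by (intro power_mono) auto
  moreover have L: "ln (1 / \<epsilon>\<^sub>0) \<le> ln (1 / \<epsilon>)" "0 \<le> ln (1 / \<epsilon>\<^sub>0)" using e by (auto simp: ln_div)
  ultimately have *: "(1 / 16)\<^sup>2 * ln (1 / \<epsilon>\<^sub>0) \<le> \<epsilon>\<^sup>2 * ln (1 / \<epsilon>)" by (intro mult_mono) auto
  have "ln (real d) / 2 * ((1 / 16)\<^sup>2 * ln (1 / \<epsilon>\<^sub>0)) \<le> real (card slice) * (\<epsilon>\<^sup>2 * ln (1 / \<epsilon>))"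
    by (rule mult_mono[OF M *]) (use L in auto)
  thus ?thesis by (simp add: power2_eq_square mult_ac)
qed

end

text \<open>The exponent \<kappa> solves \<open>\<kappa> * (ln d - ln L) = 2 * L\<close>, where
  \<open>exp (2 * L)\<close> is the inverse square of \<epsilon>. Since \<open>k\<close> is at most
  \<open>L + 1\<close>, \<open>(d / k) ^ k\<close> has nearly this size. Rounding costs
  \<open>exp (- 3)\<close>, and having \<open>d - 1\<close> in place of \<open>d\<close> costs a
  factor 2.\<close>

lemma choose_ge_inverse_eps_square:
  fixes d k :: nat and \<epsilon> :: real
  assumes d: "1 \<le> d" and e: "\<epsilon> \<le> 1 / (2 * sqrt (real d))" "exp (- real d / 8) \<le> \<epsilon>"
    and k: "k = nat \<lceil>net_exponent d \<epsilon>\<rceil>"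
  shows "0 < net_exponent d \<epsilon>" and "exp (- 3) / 2 \<le> real ((d - 1) choose k) * \<epsilon>\<^sup>2"
proof -
  define L D \<kappa> where "L = ln (1 / \<epsilon>)" and "D = ln (real d) - ln L" and "\<kappa> = net_exponent d \<epsilon>"
  have e0: "0 < \<epsilon>" using e(2) exp_gt_zero less_le_trans by blast
  have "1 / (2 * sqrt (real d)) \<le> 1 / 2" using d by (simp add: field_simps)
  hence e12: "\<epsilon> \<le> 1 / 2" using e by linarith
  have "ln 2 \<le> L"
    unfolding L_def using e0 e12 by (subst ln_le_cancel_iff) (auto simp: field_simps)
  hence L: "1 / 2 \<le> L" using ln2_ge_two_thirds by linarith
  have "ln (exp (- real d / 8)) \<le> ln \<epsilon>" using e e0 by (subst ln_le_cancel_iff) auto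
  hence Ld: "L \<le> real d / 8" using e0 by (simp add: L_def ln_div)
  have d4: "4 \<le> real d" using L Ld by linarith
  \<comment> \<open>From \<open>L \<le> d / 8\<close> the ratio \<open>d / L\<close> is at least 8,
    which exceeds \<open>exp 2\<close>. This gives \<open>\<kappa> \<le> L\<close>.\<close>
  have D: "2 \<le> D"
  proof -
    have "exp 2 = (exp 1 :: real) * exp 1" by (simp add: exp_add[symmetric])
    also have "\<dots> \<le> (272 / 100) * (272 / 100)" using e_less_272 by (intro mult_mono) auto
    finally have "exp 2 \<le> (8 :: real)" by simp
    also have "8 \<le> real d / L" using L Ld by (simp add: field_simps)
    finally have "2 \<le> ln (real d / L)" using L d4 by (subst ln_ge_iff) auto
    thus ?thesis using L d4 by (simp add: D_def ln_div)
  qed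
  have \<kappa>: "\<kappa> = 2 * L / D" by (simp add: \<kappa>_def net_exponent_def L_def D_def)
  show pos: "0 < net_exponent d \<epsilon>" using \<kappa> L D by (simp add: \<kappa>_def)
  have "\<kappa> \<le> L" unfolding \<kappa> using L D by (simp add: field_simps)
  moreover have k\<kappa>: "\<kappa> \<le> real k" "real k \<le> \<kappa> + 1" "1 \<le> k"
    using pos unfolding k \<kappa>_def by linarith+
  ultimately have kL: "real k \<le> L + 1" by linarith
  have kd: "real k \<le> real d / 2" using kL Ld d4 by linarith
  have "real k \<le> real d - 1" using kd d4 by linarith
  hence kd1: "k \<le> d - 1" by linarith
  \<comment> \<open>Rounding up raises \<open>ln k\<close> above \<open>ln L\<close> by at most
    \<open>1 / L\<close>; over \<open>k\<close> factors this loses \<open>k / L\<close>, which is at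
    most 3.\<close>
  have "L * (1 + 1 / L) = L + 1" using L by (simp add: field_simps)
  hence "ln (real k) \<le> ln (L * (1 + 1 / L))"
    using kL k\<kappa> L by (subst ln_le_cancel_iff) auto
  also have "\<dots> = ln L + ln (1 + 1 / L)" using L by (intro ln_mult_pos) (auto simp: add_pos_pos)
  also have "\<dots> \<le> ln L + 1 / L" using L by (intro add_left_mono ln_add_one_self_le_self) auto
  finally have lnk: "ln (real k) \<le> ln L + 1 / L" .
  have "real k / L \<le> 1 + 1 / L" using kL L by (simp add: field_simps)
  also have "1 / L \<le> 2" using L by (simp add: field_simps)
  finally have kL3: "real k / L \<le> 3" by simp
  have "2 * L = \<kappa> * D" using D by (simp add: \<kappa>)
  also have "\<dots> \<le> real k * D" using k\<kappa> D by (intro mult_right_mono) auto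
  finally have "2 * L - 3 \<le> real k * D - real k / L" using kL3 by linarith
  also have "\<dots> = real k * (ln (real d) - (ln L + 1 / L))" by (simp add: D_def algebra_simps)
  also have "\<dots> \<le> real k * (ln (real d) - ln (real k))" using lnk by (intro mult_left_mono) auto
  also have "\<dots> = real k * ln (real d / real k)" using k\<kappa> d4 by (simp add: ln_div)
  finally have "exp (2 * L - 3) \<le> exp (real k * ln (real d / real k))" by simp
  also have "\<dots> = (real d / real k) ^ k" using k\<kappa> d4 by (simp add: exp_of_nat_mult)
  finally have dk: "exp (2 * L - 3) \<le> (real d / real k) ^ k" .
  \<comment> \<open>Bernoulli's inequality: replacing \<open>d\<close> by \<open>d - 1\<close> in
    the \<open>k\<close>-th power at most halves it, because \<open>k \<le> d / 2\<close>.\<close>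
  have "1 / 2 \<le> 1 + real k * (- (1 / real d))" using kd d4 by (simp add: field_simps)
  also have "\<dots> \<le> (1 + - (1 / real d)) ^ k" using d4 by (intro Bernoulli_inequality) (auto simp: field_simps)
  finally have "1 / 2 * exp (2 * L - 3) \<le> (1 + - (1 / real d)) ^ k * (real d / real k) ^ k"
    using dk by (intro mult_mono) auto
  also have "1 + - (1 / real d) = real (d - 1) / real d"
    using d by (simp add: of_nat_diff field_simps)
  also have "(real (d - 1) / real d) ^ k * (real d / real k) ^ k = (real (d - 1) / real k) ^ k"
    using d unfolding power_mult_distrib[symmetric] by simp
  also have "\<dots> \<le> real ((d - 1) choose k)" by (rule binomial_ge_n_over_k_pow_k[OF kd1])
  finally have "1 / 2 * exp (2 * L - 3) * \<epsilon>\<^sup>2 \<le> real ((d - 1) choose k) * \<epsilon>\<^sup>2"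
    by (rule mult_right_mono) auto
  moreover have "exp (2 * L - 3) * \<epsilon>\<^sup>2 = exp (- 3)"
  proof -
    have "exp (2 * L - 3) = exp L ^ 2 * exp (- 3)" by (simp add: exp_add[symmetric] power2_eq_square)
    thus ?thesis using e0 by (simp add: L_def field_simps)
  qed
  ultimately show "exp (- 3) / 2 \<le> real ((d - 1) choose k) * \<epsilon>\<^sup>2" by (simp add: mult.assoc)
qed

section \<open>The four asymptotic estimates\<close>

lemma ln_dim_bound:
  fixes \<epsilon>\<^sub>0 :: real
  assumes "0 < \<epsilon>\<^sub>0" "\<epsilon>\<^sub>0 < 1"
  shows "\<exists>C>0. \<forall>d q n m \<epsilon> P. 1 \<le> d \<and> 2 \<le> q \<and> 2 \<le> n \<and> 0 < m \<and> almost_net d q n m \<epsilon> P \<and>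
    1 / (2 * sqrt (real d)) \<le> \<epsilon> \<and> \<epsilon> \<le> \<epsilon>\<^sub>0 \<longrightarrow>
    m \<ge> C * (ln (real d) / ((real q)\<^sup>2 * \<epsilon>\<^sup>2 * ln (1 / \<epsilon>)))"
proof -
  define c where "c = min (1 / 256) (ln (1 / \<epsilon>\<^sub>0) / 512)"
  have c: "0 < c" using assms by (simp add: c_def)
  have "c / 2 * (ln (real d) / ((real q)\<^sup>2 * \<epsilon>\<^sup>2 * ln (1 / \<epsilon>))) \<le> m"
    if d: "1 \<le> d" and q: "2 \<le> q" and n: "2 \<le> n" and m: "0 < m" and net: "almost_net d q n m \<epsilon> P"
      and e: "1 / (2 * sqrt (real d)) \<le> \<epsilon>" "\<epsilon> \<le> \<epsilon>\<^sub>0" for d q n m \<epsilon> P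
  \<comment> \<open>For \<open>d = 1\<close> the claimed bound is zero, as
    \<open>ln 1 = 0\<close>.\<close>
  proof (cases "d = 1")
    case False
    hence d2: "2 \<le> d" using d by simp
    interpret net_slice d q n 1 m \<epsilon> P using d q n m net by unfold_locales auto
    have "0 < 1 / (2 * sqrt (real d))" using d by simp
    hence e0: "0 < \<epsilon>" using e by linarith
    have L: "0 < ln (1 / \<epsilon>)" using e0 e assms by simp
    have lnd: "0 \<le> ln (real d)" using d by simp
    have "c * ln (real d) \<le> real (card slice) * \<epsilon>\<^sup>2 * ln (1 / \<epsilon>)"
    proof (cases "\<epsilon> \<le> 1 / 16")
      case True
      have "c * ln (real d) \<le> 1 / 256 * ln (real d)"
        using lnd by (intro mult_right_mono) (auto simp: c_def)
      thus ?thesis using ln_dim_bound_small_eps[OF refl d2 e(1) True] by linarith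
    next
      case False
      have "c * ln (real d) \<le> ln (1 / \<epsilon>\<^sub>0) / 512 * ln (real d)"
        using lnd by (intro mult_right_mono) (auto simp: c_def)
      thus ?thesis using ln_dim_bound_large_eps[OF refl d2 _ e(2) assms(2)] False by linarith
    qed
    also have "\<dots> \<le> 2 * m * (real q)\<^sup>2 * \<epsilon>\<^sup>2 * ln (1 / \<epsilon>)"
      using card_slice_le e assms L by (intro mult_right_mono) auto
    finally show ?thesis
      using q e0 L by (simp add: pos_divide_le_eq mult_ac)
  qed (use that in auto)
  thus ?thesis using c by (intro exI[of _ "c / 2"]) auto
qed

text \<open>The case \<open>p = 1\<close> with \<open>k\<close> the rounded-up exponent. Rounding
  gives \<open>2 * k \<le> 2 * \<kappa> + 2\<close>, which explains the extra factor
  \<open>real q powr (- 2)\<close>; the condition on \<open>n\<close> is what the slice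
  needs.\<close>

lemma net_exponent_bound:
  "\<exists>C>0. \<forall>d q n m \<epsilon> P. 1 \<le> d \<and> 2 \<le> q \<and> 2 * \<lceil>net_exponent d \<epsilon>\<rceil> \<le> int n \<and> 0 < m \<and>
     almost_net d q n m \<epsilon> P \<and> \<epsilon> \<le> 1 / (2 * sqrt (real d)) \<and> exp (- real d / 8) \<le> \<epsilon> \<longrightarrow>
     m \<ge> C * (real q powr (- 2 * net_exponent d \<epsilon> - 2) * \<epsilon> powr (- 2))"
proof -
  define c :: real where "c = exp (- 3) / 2"
  define C where "C = c / (18 + 8 * c)"
  have c: "0 < c" by (simp add: c_def)
  hence C: "0 < C" by (simp add: C_def add_pos_pos)
  have "C * (real q powr (- 2 * net_exponent d \<epsilon> - 2) * \<epsilon> powr (- 2)) \<le> m"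
    if d: "1 \<le> d" and q: "2 \<le> q" and n: "2 * \<lceil>net_exponent d \<epsilon>\<rceil> \<le> int n" and m: "0 < m"
      and net: "almost_net d q n m \<epsilon> P"
      and e: "\<epsilon> \<le> 1 / (2 * sqrt (real d))" "exp (- real d / 8) \<le> \<epsilon>" for d q n m \<epsilon> P
  proof -
    define \<kappa> k where "\<kappa> = net_exponent d \<epsilon>" and "k = nat \<lceil>net_exponent d \<epsilon>\<rceil>"
    note choose = choose_ge_inverse_eps_square[OF d e k_def]
    have k: "real k \<le> \<kappa> + 1" "2 * k \<le> n"
      using choose(1) n unfolding k_def \<kappa>_def by linarith+
    interpret net_slice d q n k m \<epsilon> P using d q k m net by unfold_locales auto
    have e0: "0 < \<epsilon>" using e(2) exp_gt_zero less_le_trans by blast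
    have "1 / (2 * sqrt (real d)) \<le> 1 / 2" using d by (simp add: field_simps)
    hence e12: "\<epsilon> \<le> 1 / 2" using e by linarith
    have "C \<le> m * real q ^ (2 * k) * \<epsilon>\<^sup>2"
      unfolding C_def using c choose(2) by (intro single_power_bound e12) (auto simp: c_def)
    also have "real q ^ (2 * k) = real q powr (real (2 * k))" using q by (subst powr_realpow) auto
    also have "m * \<dots> * \<epsilon>\<^sup>2 \<le> m * real q powr (2 * \<kappa> + 2) * \<epsilon>\<^sup>2"
      using k q m by (intro mult_right_mono mult_left_mono powr_mono) auto
    finally have *: "C \<le> m * real q powr (2 * \<kappa> + 2) * \<epsilon>\<^sup>2" .
    have "real q powr (- 2 * \<kappa> - 2) = 1 / real q powr (2 * \<kappa> + 2)"
      by (simp add: powr_minus_divide[symmetric])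
    moreover have "\<epsilon> powr (- 2) = 1 / \<epsilon>\<^sup>2" using e0 by (simp add: powr_minus_divide)
    ultimately have "C * (real q powr (- 2 * \<kappa> - 2) * \<epsilon> powr (- 2)) =
        C / (real q powr (2 * \<kappa> + 2) * \<epsilon>\<^sup>2)" by simp
    also have "\<dots> \<le> m" using * q e0 by (simp add: pos_divide_le_eq mult.assoc)
    finally show ?thesis by (simp add: \<kappa>_def)
  qed
  thus ?thesis using C by (intro exI[of _ C]) auto
qed

text \<open>For \<epsilon> above a fixed negative power of \<open>d\<close>,
  \<open>ln (1 / \<epsilon>)\<close> is \<open>O(ln d)\<close>, so \<open>net_exponent\<close> stays
  bounded and the power of \<open>q\<close> becomes a constant. The values of \<epsilon> above
  \<open>1 / (2 * sqrt d)\<close> are treated separately.\<close>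

lemma polynomial_eps_bound:
  fixes q :: nat and t :: real
  assumes q: "2 \<le> q"
  shows "\<exists>C>0. \<forall>m \<epsilon> :: nat \<Rightarrow> real. \<epsilon> \<in> \<omega>(\<lambda>d. real d powr (- t)) \<and>
    (\<forall>\<^sub>F d in sequentially. 0 < m d \<and> \<epsilon> d < 1 \<and>
      (\<exists>n P. 2 * \<lceil>net_exponent d (\<epsilon> d)\<rceil> \<le> int n \<and> almost_net d q n (m d) (\<epsilon> d) P)) \<longrightarrow>
    (\<forall>\<^sub>F d in sequentially. m d \<ge> C * (1 / (\<epsilon> d)\<^sup>2))"
proof -
  obtain C\<^sub>2 where C2: "0 < C\<^sub>2" and bound: "\<And>d q n m \<epsilon> P. 1 \<le> d \<Longrightarrow> 2 \<le> q \<Longrightarrow>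
      2 * \<lceil>net_exponent d \<epsilon>\<rceil> \<le> int n \<Longrightarrow> 0 < m \<Longrightarrow> almost_net d q n m \<epsilon> P \<Longrightarrow>
      \<epsilon> \<le> 1 / (2 * sqrt (real d)) \<Longrightarrow> exp (- real d / 8) \<le> \<epsilon> \<Longrightarrow>
      C\<^sub>2 * (real q powr (- 2 * net_exponent d \<epsilon> - 2) * \<epsilon> powr (- 2)) \<le> m"
    using net_exponent_bound by blast
  define t' where "t' = max t 1"
  \<comment> \<open>One constant for each range of \<epsilon>: at least \<open>1 / 2\<close>,
    intermediate, and at most \<open>1 / (2 * sqrt d)\<close>. The number 152 comes from
    \<open>c / (18 + 8 * c)\<close> at \<open>c = 1 / 8\<close>.\<close>
  define C where "C = min (1 / 8) (min (1 / (152 * (real q)\<^sup>2)) (C\<^sub>2 * real q powr (- 8 * t' - 2)))"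
  have t': "1 \<le> t'" "t \<le> t'" by (auto simp: t'_def)
  have C: "0 < C" using q C2 by (simp add: C_def)
  have pointwise: "C * (1 / \<epsilon>\<^sup>2) \<le> m"
    if d2: "2 \<le> d" and de: "exp (- real d / 8) \<le> real d powr (- t')"
      and lnd: "ln (t' * ln (real d)) \<le> ln (real d) / 2"
      and e: "real d powr (- t) \<le> \<bar>\<epsilon>\<bar>" "\<epsilon> < 1" and m: "0 < m"
      and n: "2 * \<lceil>net_exponent d \<epsilon>\<rceil> \<le> int n" and net: "almost_net d q n m \<epsilon> P" for d n m \<epsilon> P
  proof -
    define L D \<kappa> where "L = ln (1 / \<epsilon>)" and "D = ln (real d) - ln L" and "\<kappa> = net_exponent d \<epsilon>"
    \<comment> \<open>The slice with \<open>k = 0\<close> exists for every \<open>n\<close>. It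
      yields the sign of \<epsilon> and, being nonempty, \<open>1 / 2 \<le> m\<close>.\<close>
    interpret s0: net_slice d q n 0 m \<epsilon> P using d2 q m net by unfold_locales auto
    have "real d powr (- t') \<le> real d powr (- t)" using d2 t' by (intro powr_mono) auto
    hence edt: "real d powr (- t') \<le> \<epsilon>" using e s0.eps_nonneg by linarith
    moreover have "0 < real d powr (- t')" using d2 by simp
    ultimately have e0: "0 < \<epsilon>" by linarith
    have lnd0: "0 < ln (real d)" using d2 by simp
    have L0: "0 < L" using e0 e by (simp add: L_def)
    have "ln (real d powr (- t')) \<le> ln \<epsilon>" using edt e0 d2 by (subst ln_le_cancel_iff) auto
    hence L: "L \<le> t' * ln (real d)" using e0 d2 by (simp add: L_def ln_div ln_powr)
    hence "ln L \<le> ln (t' * ln (real d))" using L0 by (subst ln_le_cancel_iff) auto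
    hence D: "ln (real d) / 2 \<le> D" using lnd by (simp add: D_def)
    have D0: "0 < D" using D lnd0 by linarith
    have \<kappa>: "\<kappa> = 2 * L / D" by (simp add: \<kappa>_def net_exponent_def L_def D_def)
    hence \<kappa>0: "0 < \<kappa>" using L0 D0 by simp
    \<comment> \<open>A positive exponent rounds up to at least 1, so \<open>n \<ge> 2\<close> and
      the slice with \<open>k = 1\<close> is available in the middle range.\<close>
    hence "1 \<le> \<lceil>net_exponent d \<epsilon>\<rceil>" by (simp add: \<kappa>_def)
    hence n2: "2 \<le> n" using n by linarith
    have "t' * (ln (real d) / 2) \<le> t' * D" using D t' by (intro mult_left_mono) auto
    hence "2 * L \<le> 4 * t' * D" using L by (simp add: mult_ac)
    hence \<kappa>t: "\<kappa> \<le> 4 * t'" using D0 by (simp add: \<kappa> divide_le_eq)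
    consider "1 / 2 \<le> \<epsilon>" | "\<epsilon> \<le> 1 / 2" "1 / (2 * sqrt (real d)) \<le> \<epsilon>"
      | "\<epsilon> \<le> 1 / (2 * sqrt (real d))" by linarith
    thus ?thesis
    proof cases
      case 1
      have "1 \<le> real (card s0.slice)" using s0.card_slice_pos e by simp
      also have "\<dots> \<le> 2 * m" using s0.card_slice_le e by simp
      finally have m2: "1 / 2 \<le> m" by simp
      have "(1 / 2)\<^sup>2 \<le> \<epsilon>\<^sup>2" using 1 by (intro power_mono) auto
      hence "1 / \<epsilon>\<^sup>2 \<le> 4" using e0 by (simp add: power2_eq_square field_simps)
      hence "C * (1 / \<epsilon>\<^sup>2) \<le> 1 / 8 * 4" using C by (intro mult_mono) (auto simp: C_def)
      also have "\<dots> \<le> m" using m2 by simp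
      finally show ?thesis .
    next
      case 2
      interpret s1: net_slice d q n 1 m \<epsilon> P using d2 q m net n2 by unfold_locales auto
      have "(1 / (2 * sqrt (real d)))\<^sup>2 \<le> \<epsilon>\<^sup>2" using 2 by (intro power_mono) auto
      hence "1 / (4 * real d) \<le> \<epsilon>\<^sup>2" by (simp add: power_divide power_mult_distrib)
      hence "real (d - 1) * (1 / (4 * real d)) \<le> real (d - 1) * \<epsilon>\<^sup>2" by (intro mult_left_mono) auto
      moreover have "1 / 8 \<le> real (d - 1) * (1 / (4 * real d))"
        using d2 by (simp add: of_nat_diff field_simps)
      ultimately have "1 / 8 \<le> real (d - 1) * \<epsilon>\<^sup>2" by (rule order_trans[rotated])
      hence "1 / 8 \<le> real ((d - 1) choose 1) * \<epsilon>\<^sup>2" by (simp only: choose_one)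
      from s1.single_power_bound[OF 2(1) _ this] have "1 / 152 \<le> m * (real q)\<^sup>2 * \<epsilon>\<^sup>2" by simp
      hence "1 / (152 * (real q)\<^sup>2) * (1 / \<epsilon>\<^sup>2) \<le> m" using q e0 by (simp add: field_simps)
      moreover have "C * (1 / \<epsilon>\<^sup>2) \<le> 1 / (152 * (real q)\<^sup>2) * (1 / \<epsilon>\<^sup>2)"
        by (intro mult_right_mono) (auto simp: C_def)
      ultimately show ?thesis by linarith
    next
      case 3
      have "C * (1 / \<epsilon>\<^sup>2) \<le> C\<^sub>2 * real q powr (- 8 * t' - 2) * (1 / \<epsilon>\<^sup>2)"
        by (intro mult_right_mono) (auto simp: C_def)
      also have "\<dots> \<le> C\<^sub>2 * real q powr (- 2 * \<kappa> - 2) * (1 / \<epsilon>\<^sup>2)"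
        using \<kappa>t q C2 by (intro mult_right_mono mult_left_mono powr_mono) auto
      also have "\<dots> = C\<^sub>2 * (real q powr (- 2 * \<kappa> - 2) * \<epsilon> powr (- 2))"
        using e0 by (simp add: powr_minus_divide)
      also have "\<dots> \<le> m"
        unfolding \<kappa>_def using d2 de edt by (intro bound[OF _ q n m net 3]) auto
      finally show ?thesis .
    qed
  qed
  have "\<forall>\<^sub>F d in sequentially. C * (1 / (\<epsilon> d)\<^sup>2) \<le> m d"
    if om: "\<epsilon> \<in> \<omega>(\<lambda>d. real d powr (- t))"
      and ev: "\<forall>\<^sub>F d in sequentially. 0 < m d \<and> \<epsilon> d < 1 \<and>
        (\<exists>n P. 2 * \<lceil>net_exponent d (\<epsilon> d)\<rceil> \<le> int n \<and> almost_net d q n (m d) (\<epsilon> d) P)"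
    for m \<epsilon> :: "nat \<Rightarrow> real"
  proof -
    have "\<forall>\<^sub>F d in sequentially. 1 * norm (real d powr (- t)) \<le> norm (\<epsilon> d)"
      by (rule landau_omega.smallD[OF om]) auto
    moreover have "\<forall>\<^sub>F d in sequentially. exp (- real d / 8) \<le> real d powr (- t')"
      using t' by real_asymp
    moreover have "\<forall>\<^sub>F d in sequentially. ln (t' * ln (real d)) \<le> ln (real d) / 2"
      using t' by real_asymp
    ultimately show ?thesis
      using ev eventually_ge_at_top[of 2]
    proof eventually_elim
      case (elim d)
      thus ?case using pointwise[of d "\<epsilon> d" "m d"] by auto
    qed
  qed
  thus ?thesis using C by (intro exI[of _ C]) blast
qed

text \<open>Lets a rapidly decaying \<epsilon> be replaced by \<open>exp (- c * real d)\<close>,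
  where \<open>net_exponent_bound\<close> applies.\<close>

lemma almost_net_mono:
  assumes "almost_net d q n m \<epsilon> P" "\<epsilon> \<le> \<delta>" "0 < m"
  shows "almost_net d q n m \<delta> P"
proof -
  have "(1 - \<delta>) * m \<le> (1 - \<epsilon>) * m" "(1 + \<epsilon>) * m \<le> (1 + \<delta>) * m"
    using assms by (auto intro!: mult_right_mono)
  thus ?thesis using assms(1) unfolding almost_net_def by (meson order_trans)
qed

text \<open>Here \<open>ln (1 / \<epsilon>) = c * d\<close>, so \<open>d\<close> cancels in the
  denominator and \<open>ln (1 / c)\<close> remains.\<close>

lemma net_exponent_exp:
  assumes "1 \<le> d" "0 < c"
  shows "net_exponent d (exp (- c * real d)) = 2 * c * real d / ln (1 / c)"
proof -
  have "ln (1 / exp (- c * real d)) = c * real d" by (simp add: exp_minus ln_inverse ln_div)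
  thus ?thesis using assms by (simp add: net_exponent_def ln_mult_pos ln_div mult.assoc)
qed

text \<open>With \<epsilon> raised to \<open>exp (- c * real d)\<close>, the gain
  \<open>exp (2 * c * d)\<close> and the loss \<open>exp (- 4 * c * d * ln q / ln (1 / c))\<close>
  combine to the stated exponent, which is positive as \<open>c < 1 / (real q)\<^sup>2\<close>. The
  constant is that of \<open>net_exponent_bound\<close>, hence uniform in \<open>q\<close> and
  \<open>c\<close>.\<close>

lemma exponential_eps_bound:
  "\<exists>C>0. \<forall>(q::nat) (c::real) (m::nat \<Rightarrow> real) (\<epsilon>::nat \<Rightarrow> real).
     2 \<le> q \<and> 0 < c \<and> c < min (1 / 8) (1 / (real q)\<^sup>2) \<and> \<epsilon> \<in> o(\<lambda>d. exp (- c * real d)) \<and>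
     (\<forall>\<^sub>F d in sequentially. 0 < m d \<and>
        (\<exists>n P. 2 * \<lceil>net_exponent d (exp (- c * real d))\<rceil> \<le> int n \<and>
               almost_net d q n (m d) (\<epsilon> d) P)) \<longrightarrow>
     (\<forall>\<^sub>F d in sequentially.
        m d \<ge> C * (real q powr (- 2) *
               exp (2 * c * (1 - 2 * ln (real q) / ln (1 / c)) * real d)))"
proof -
  obtain C where C: "0 < C" and bound: "\<And>d q n m \<epsilon> P. 1 \<le> d \<Longrightarrow> 2 \<le> q \<Longrightarrow>
      2 * \<lceil>net_exponent d \<epsilon>\<rceil> \<le> int n \<Longrightarrow> 0 < m \<Longrightarrow> almost_net d q n m \<epsilon> P \<Longrightarrow>
      \<epsilon> \<le> 1 / (2 * sqrt (real d)) \<Longrightarrow> exp (- real d / 8) \<le> \<epsilon> \<Longrightarrow>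
      C * (real q powr (- 2 * net_exponent d \<epsilon> - 2) * \<epsilon> powr (- 2)) \<le> m"
    using net_exponent_bound by blast
  have "\<forall>\<^sub>F d in sequentially. C * (real q powr (- 2) *
      exp (2 * c * (1 - 2 * ln (real q) / ln (1 / c)) * real d)) \<le> m d"
    if q: "2 \<le> q" and c: "0 < c" "c < min (1 / 8) (1 / (real q)\<^sup>2)"
      and small: "\<epsilon> \<in> o(\<lambda>d. exp (- c * real d))"
      and ev: "\<forall>\<^sub>F d in sequentially. 0 < m d \<and>
        (\<exists>n P. 2 * \<lceil>net_exponent d (exp (- c * real d))\<rceil> \<le> int n \<and> almost_net d q n (m d) (\<epsilon> d) P)"
    for q :: nat and c :: real and m \<epsilon> :: "nat \<Rightarrow> real"
  proof -
    have "\<forall>\<^sub>F d in sequentially. norm (\<epsilon> d) \<le> 1 * norm (exp (- c * real d))"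
      by (rule landau_o.smallD[OF small]) auto
    moreover have "\<forall>\<^sub>F d in sequentially. exp (- c * real d) \<le> 1 / (2 * sqrt (real d))"
      using c(1) by real_asymp
    ultimately show ?thesis
      using ev eventually_ge_at_top[of 1]
    proof eventually_elim
      case (elim d)
      define \<kappa> where "\<kappa> = net_exponent d (exp (- c * real d))"
      obtain n P where n: "2 * \<lceil>net_exponent d (exp (- c * real d))\<rceil> \<le> int n"
        and net: "almost_net d q n (m d) (\<epsilon> d) P" using elim by blast
      have "\<epsilon> d \<le> exp (- c * real d)" using elim(1) by simp
      hence net': "almost_net d q n (m d) (exp (- c * real d)) P"
        using almost_net_mono[OF net] elim by blast
      have "exp (- real d / 8) \<le> exp (- c * real d)"
        using c(2) mult_right_mono[of c "1 / 8" "real d"] by simp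
      from bound[OF elim(4) q n _ net' elim(2) this] elim
      have "C * (real q powr (- 2 * \<kappa> - 2) * exp (- c * real d) powr (- 2)) \<le> m d"
        by (simp add: \<kappa>_def)
      also have "real q powr (- 2 * \<kappa> - 2) = real q powr (- 2) * exp (- 2 * \<kappa> * ln (real q))"
        using q by (simp add: powr_def exp_add[symmetric] algebra_simps)
      also have "exp (- c * real d) powr (- 2) = exp (2 * c * real d)" by (simp add: powr_def)
      also have "real q powr (- 2) * exp (- 2 * \<kappa> * ln (real q)) * exp (2 * c * real d) =
          real q powr (- 2) * exp (2 * c * (1 - 2 * ln (real q) / ln (1 / c)) * real d)"
        using net_exponent_exp[OF elim(4) c(1)]
        by (simp add: \<kappa>_def mult.assoc exp_add[symmetric] algebra_simps)
      finally show ?case .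
    qed
  qed
  thus ?thesis using C by (intro exI[of _ C]) blast
qed

theorem theorem2:
  shows
   "(\<forall>\<epsilon>\<^sub>0::real. 0 < \<epsilon>\<^sub>0 \<and> \<epsilon>\<^sub>0 < 1 \<longrightarrow>
      (\<exists>C>0. \<forall>(d::nat) (q::nat) (n::nat) (m::real) (\<epsilon>::real) P.
         1 \<le> d \<and> 2 \<le> q \<and> 2 \<le> n \<and> 0 < m \<and> almost_net d q n m \<epsilon> P \<and>
         1 / (2 * sqrt (real d)) \<le> \<epsilon> \<and> \<epsilon> \<le> \<epsilon>\<^sub>0 \<longrightarrow>
         m \<ge> C * (ln (real d) / ((real q)\<^sup>2 * \<epsilon>\<^sup>2 * ln (1 / \<epsilon>)))))
    \<and>
    (\<exists>C>0. \<forall>(d::nat) (q::nat) (n::nat) (m::real) (\<epsilon>::real) P.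
       1 \<le> d \<and> 2 \<le> q \<and> 2 * \<lceil>net_exponent d \<epsilon>\<rceil> \<le> int n \<and> 0 < m \<and> almost_net d q n m \<epsilon> P \<and>
       \<epsilon> \<le> 1 / (2 * sqrt (real d)) \<and> exp (- real d / 8) \<le> \<epsilon> \<longrightarrow>
       m \<ge> C * (real q powr (- 2 * net_exponent d \<epsilon> - 2) * \<epsilon> powr (- 2)))
    \<and>
    (\<forall>(q::nat) (t::real). 2 \<le> q \<longrightarrow>
      (\<exists>C>0. \<forall>(m::nat \<Rightarrow> real) (\<epsilon>::nat \<Rightarrow> real).
         \<epsilon> \<in> \<omega>(\<lambda>d. real d powr (- t)) \<and>
         (\<forall>\<^sub>F d in sequentially. 0 < m d \<and> \<epsilon> d < 1 \<and>
            (\<exists>n P. 2 * \<lceil>net_exponent d (\<epsilon> d)\<rceil> \<le> int n \<and> almost_net d q n (m d) (\<epsilon> d) P)) \<longrightarrow>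
         (\<forall>\<^sub>F d in sequentially. m d \<ge> C * (1 / (\<epsilon> d)\<^sup>2))))
    \<and>
    (\<exists>C>0. \<forall>(q::nat) (c::real) (m::nat \<Rightarrow> real) (\<epsilon>::nat \<Rightarrow> real).
       2 \<le> q \<and> 0 < c \<and> c < min (1 / 8) (1 / (real q)\<^sup>2) \<and>
       \<epsilon> \<in> o(\<lambda>d. exp (- c * real d)) \<and>
       (\<forall>\<^sub>F d in sequentially. 0 < m d \<and>
          (\<exists>n P. 2 * \<lceil>net_exponent d (exp (- c * real d))\<rceil> \<le> int n \<and>
                 almost_net d q n (m d) (\<epsilon> d) P)) \<longrightarrow>
       (\<forall>\<^sub>F d in sequentially.
          m d \<ge> C * (real q powr (- 2) *
                 exp (2 * c * (1 - 2 * ln (real q) / ln (1 / c)) * real d))))"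
  by (intro conjI allI impI ln_dim_bound net_exponent_bound polynomial_eps_bound exponential_eps_bound)
    auto

end
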